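(* An irreflexive binary relation $R$ on a finite set $P$ is a dicograph if and only if the following three conditions hold: (i) the directed part $\vec R=\{(a,b)\in R \mid (b,a)\notin R\}$ is N-free (i.e. $\vec R$ is a series-parallel order); (ii) the symmetric part $\bar R=\{(a,b)\in R \mid (b,a)\in R\}$ is $P_4$-free (i.e. $\bar R$ is a cograph); (iii) weak transitivity: for all $a,b,c\in P$, if $(a,b)\in\vec R$ and $(b,c)\in R$ then $(a,c)\in R$, and if $(a,b)\in R$ and $(b,c)\in\vec R$ then $(a,c)\in R$.
   Context: Dicographs (directed cographs) are the smallest class of irreflexive binary relations containing the empty relation on singleton sets and closed under the following three operations on relations $R_1,R_2$ with disjoint domains $E_1,E_2$, yielding a relation on $E_1\uplus E_2$: symmetric series composition $R_1\,\widehat{\otimes}\,R_2=R_1\uplus R_2\uplus(E_1\times E_2)\uplus(E_2\times E_1)$; directed series composition $R_1\,\widehat{<}\,R_2=R_1\uplus R_2\uplus(E_1\times E_2)$; and parallel composition $R_1\,\widehat{⅋}\,R_2=R_1\uplus R_2$ (the hat over the par symbol ⅋ denotes this parallel composition of relations). A relation is N-free if it contains no induced N pattern, and $P_4$-free if it contains no induced path on four vertices. *)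

theory Defs
  imports Main
begin

definition sym_series :: "'a set \<Rightarrow> 'a rel \<Rightarrow> 'a set \<Rightarrow> 'a rel \<Rightarrow> 'a rel" where
  "sym_series E\<^sub>1 R\<^sub>1 E\<^sub>2 R\<^sub>2 = R\<^sub>1 \<union> R\<^sub>2 \<union> E\<^sub>1 \<times> E\<^sub>2 \<union> E\<^sub>2 \<times> E\<^sub>1"

definition dir_series :: "'a set \<Rightarrow> 'a rel \<Rightarrow> 'a set \<Rightarrow> 'a rel \<Rightarrow> 'a rel" where
  "dir_series E\<^sub>1 R\<^sub>1 E\<^sub>2 R\<^sub>2 = R\<^sub>1 \<union> R\<^sub>2 \<union> E\<^sub>1 \<times> E\<^sub>2"

definition parallel :: "'a rel \<Rightarrow> 'a rel \<Rightarrow> 'a rel" where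
  "parallel R\<^sub>1 R\<^sub>2 = R\<^sub>1 \<union> R\<^sub>2"

text \<open>A relation is carried together with its domain, since the domain cannot be recovered
  from the set of pairs (isolated points). There is no dicograph on the empty domain.\<close>

inductive dicograph :: "'a set \<Rightarrow> 'a rel \<Rightarrow> bool" where
  singleton: "dicograph {x} {}"
| sym_series: "dicograph E\<^sub>1 R\<^sub>1 \<Longrightarrow> dicograph E\<^sub>2 R\<^sub>2 \<Longrightarrow> E\<^sub>1 \<inter> E\<^sub>2 = {}
    \<Longrightarrow> dicograph (E\<^sub>1 \<union> E\<^sub>2) (sym_series E\<^sub>1 R\<^sub>1 E\<^sub>2 R\<^sub>2)"
| dir_series: "dicograph E\<^sub>1 R\<^sub>1 \<Longrightarrow> dicograph E\<^sub>2 R\<^sub>2 \<Longrightarrow> E\<^sub>1 \<inter> E\<^sub>2 = {}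
    \<Longrightarrow> dicograph (E\<^sub>1 \<union> E\<^sub>2) (dir_series E\<^sub>1 R\<^sub>1 E\<^sub>2 R\<^sub>2)"
| parallel: "dicograph E\<^sub>1 R\<^sub>1 \<Longrightarrow> dicograph E\<^sub>2 R\<^sub>2 \<Longrightarrow> E\<^sub>1 \<inter> E\<^sub>2 = {}
    \<Longrightarrow> dicograph (E\<^sub>1 \<union> E\<^sub>2) (parallel R\<^sub>1 R\<^sub>2)"

definition directed_part :: "'a rel \<Rightarrow> 'a rel" where
  "directed_part R = {(a, b). (a, b) \<in> R \<and> (b, a) \<notin> R}"

definition symmetric_part :: "'a rel \<Rightarrow> 'a rel" where
  "symmetric_part R = {(a, b). (a, b) \<in> R \<and> (b, a) \<in> R}"

text \<open>Every vertex of the two patterns below lies on an edge, so the domain of the relation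
  need not be mentioned.\<close>

definition N_free :: "'a rel \<Rightarrow> bool" where
  "N_free R \<longleftrightarrow> \<not> (\<exists>a b c d. distinct [a, b, c, d] \<and>
     Restr R {a, b, c, d} = {(a, b), (c, b), (c, d)})"

definition P4_free :: "'a rel \<Rightarrow> bool" where
  "P4_free R \<longleftrightarrow> \<not> (\<exists>a b c d. distinct [a, b, c, d] \<and>
     Restr R {a, b, c, d} = {(a, b), (b, a), (b, c), (c, b), (c, d), (d, c)})"

definition weakly_transitive :: "'a set \<Rightarrow> 'a rel \<Rightarrow> bool" where
  "weakly_transitive P R \<longleftrightarrow> (\<forall>a\<in>P. \<forall>b\<in>P. \<forall>c\<in>P.
     ((a, b) \<in> directed_part R \<and> (b, c) \<in> R \<longrightarrow> (a, c) \<in> R) \<and>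
     ((a, b) \<in> R \<and> (b, c) \<in> directed_part R \<longrightarrow> (a, c) \<in> R))"

end

theory Submission
  imports Defs
begin

text \<open>
  That the three conditions hold for every dicograph is an induction: neither N nor \<open>P\<^sub>4\<close> can be
  split into two parts all of whose cross pairs have the same type.

  Conversely, it suffices to split a relation on at least two points into two parts with all cross
  pairs of the same type. By weak transitivity the directed part is a strict partial order, and by
  N-freeness its comparability graph is \<open>P\<^sub>4\<close>-free, hence disconnected or co-disconnected. In the
  co-disconnected case, the elements of one side lying below the whole other side are cut off by a
  directed series composition. In the disconnected case, weak transitivity makes all pairs
  between two components of the comparability graph have the same type, symmetric or empty, so the
  symmetric part induces a cograph on representatives of the components, and a splitting of this
  cograph pulls back to the whole relation.
\<close>

section \<open>Splitting cographs\<close>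

text \<open>Meant for symmetric \<open>E\<close>, so each pair is tested in one direction only. With
  a predicate as edge relation the complement graph is plain negation; the diagonal values this
  creates are harmless because the four vertices are distinct.\<close>

definition P4_free_on :: "'a set \<Rightarrow> ('a \<Rightarrow> 'a \<Rightarrow> bool) \<Rightarrow> bool" where
  "P4_free_on V E \<longleftrightarrow> (\<forall>a\<in>V. \<forall>b\<in>V. \<forall>c\<in>V. \<forall>d\<in>V. distinct [a, b, c, d] \<longrightarrow>
     \<not> (E a b \<and> E b c \<and> E c d \<and> \<not> E a c \<and> \<not> E b d \<and> \<not> E a d))"

definition splits :: "'a set \<Rightarrow> 'a set \<Rightarrow> 'a set \<Rightarrow> bool" where
  "splits V A B \<longleftrightarrow> A \<noteq> {} \<and> B \<noteq> {} \<and> A \<inter> B = {} \<and> A \<union> B = V"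

lemma splits_commute: "splits V A B \<Longrightarrow> splits V B A"
  by (auto simp: splits_def)

text \<open>The path on four vertices is self-complementary: the complement of a-b-c-d is
  c-a-d-b.\<close>

lemma P4_free_on_complement:
  assumes "P4_free_on V E" and sym: "\<And>x y. E x y \<longleftrightarrow> E y x"
  shows "P4_free_on V (\<lambda>x y. \<not> E x y)"
  unfolding P4_free_on_def
proof (intro ballI impI notI)
  fix a b c d
  assume V: "a \<in> V" "b \<in> V" "c \<in> V" "d \<in> V" and "distinct [a, b, c, d]"
    and pat: "\<not> E a b \<and> \<not> E b c \<and> \<not> E c d \<and> \<not> \<not> E a c \<and> \<not> \<not> E b d \<and> \<not> \<not> E a d"
  then have "distinct [c, a, d, b]" by auto
  then have "\<not> (E c a \<and> E a d \<and> E d b \<and> \<not> E c d \<and> \<not> E a b \<and> \<not> E c b)"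
    using assms(1) V unfolding P4_free_on_def by blast
  then show False using pat sym by blast
qed

text \<open>If \<open>v\<close> has no neighbour on one side, it joins the other side. Otherwise it
  has neighbours on both sides, and P4-freeness forbids edges between its neighbours and its
  non-neighbours. Then either \<open>v\<close> is adjacent to everything, or its non-neighbours are
  cut off from all the rest.\<close>

lemma split_insert_vertex:
  assumes free: "P4_free_on (insert v V) E" and sym: "\<And>x y. E x y \<longleftrightarrow> E y x"
    and v: "v \<notin> V" and split: "splits V A B" and none: "\<forall>a\<in>A. \<forall>b\<in>B. \<not> E a b"
  shows "\<exists>A B. splits (insert v V) A B \<and>
    ((\<forall>a\<in>A. \<forall>b\<in>B. E a b) \<or> (\<forall>a\<in>A. \<forall>b\<in>B. \<not> E a b))"
proof -
  have AB: "A \<noteq> {}" "B \<noteq> {}" "A \<inter> B = {}" "A \<union> B = V"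
    using split by (auto simp: splits_def)
  have none': "\<forall>b\<in>B. \<forall>a\<in>A. \<not> E b a" using none sym by blast
  consider "\<forall>a\<in>A. \<not> E v a" | "\<forall>b\<in>B. \<not> E v b" | a b where "a \<in> A" "E v a" "b \<in> B" "E v b"
    by blast
  then show ?thesis
  proof cases
    case 1
    then have "splits (insert v V) (insert v B) A \<and> (\<forall>a\<in>insert v B. \<forall>b\<in>A. \<not> E a b)"
      using AB v none' by (auto simp: splits_def sym)
    then show ?thesis by blast
  next
    case 2
    then have "splits (insert v V) (insert v A) B \<and> (\<forall>a\<in>insert v A. \<forall>b\<in>B. \<not> E a b)"
      using AB v none by (auto simp: splits_def)
    then show ?thesis by blast
  next
    case (3 a b)
    have path: "\<not> E x y" if "x \<in> V" "y \<in> V" "z \<in> V" "\<not> E v x" "E v y" "E v z" "\<not> E x z" "\<not> E y z" "y \<noteq> z"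
      for x y z
    proof
      assume "E x y"
      moreover have "distinct [x, y, v, z]" using that v by auto
      ultimately show False
        using free[unfolded P4_free_on_def, rule_format, of x y v z] that sym[of v x] sym[of v y]
        by simp
    qed
    \<comment> \<open>An edge inside one side from a non-neighbour \<open>x\<close> to a neighbour
      \<open>y\<close> of \<open>v\<close> would extend to the induced path x-y-v-z, with
      \<open>z\<close> the neighbour of \<open>v\<close> on the opposite side.\<close>
    have same: "\<not> E x y" if xy: "x \<in> V" "y \<in> V" "\<not> E v x" "E v y" for x y
    proof -
      consider "x \<in> A" "y \<in> A" | "x \<in> B" "y \<in> B" | "x \<in> A" "y \<in> B" | "x \<in> B" "y \<in> A"
        using xy(1,2) AB(4) by blast
      then show ?thesis
      proof cases
        case 1
        then show ?thesis using 3 xy AB none by (intro path[of x y b]) auto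
      next
        case 2
        then show ?thesis using 3 xy AB none' by (intro path[of x y a]) auto
      qed (use none sym in blast)+
    qed
    show ?thesis
    proof (cases "\<forall>x\<in>V. E v x")
      case True
      then have "splits (insert v V) {v} V \<and> (\<forall>a\<in>{v}. \<forall>b\<in>V. E a b)"
        using AB v by (auto simp: splits_def)
      then show ?thesis by blast
    next
      case False
      let ?X = "{x\<in>V. \<not> E v x}" and ?Y = "insert v {y\<in>V. E v y}"
      have "splits (insert v V) ?X ?Y"
        using False v by (auto simp: splits_def)
      moreover have "\<forall>x\<in>?X. \<forall>y\<in>?Y. \<not> E x y"
        using same sym by blast
      ultimately show ?thesis by blast
    qed
  qed
qed

text \<open>Seinsche's theorem: a P4-free graph on at least two vertices is disconnected or has a
  disconnected complement. Vertices are inserted one by one; a graph whose complement is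
  disconnected is treated by passing to the complement.\<close>

lemma cograph_split:
  assumes "finite V" and "P4_free_on V E" and sym: "\<And>x y. E x y \<longleftrightarrow> E y x"
    and "x \<in> V" and "y \<in> V" and "x \<noteq> y"
  shows "\<exists>A B. splits V A B \<and> ((\<forall>a\<in>A. \<forall>b\<in>B. E a b) \<or> (\<forall>a\<in>A. \<forall>b\<in>B. \<not> E a b))"
  using assms(1,2,4-6)
proof (induction V arbitrary: x y rule: finite_induct)
  case empty
  then show ?case by simp
next
  case (insert v V)
  show ?case
  proof (cases "\<exists>w. V = {w}")
    case True
    then obtain w where "V = {w}" by blast
    \<comment> \<open>The induction hypothesis needs two vertices in \<open>V\<close>; here there is
      a single cross pair, which is trivially uniform.\<close>
    then have "splits (insert v V) {v} {w}"
      using insert.hyps by (auto simp: splits_def)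
    then show ?thesis by blast
  next
    case False
    then obtain x' y' where "x' \<in> V" "y' \<in> V" "x' \<noteq> y'"
      using insert.prems by blast
    moreover have "P4_free_on V E"
      using insert.prems(1) unfolding P4_free_on_def by blast
    ultimately obtain A B where AB: "splits V A B"
      and "(\<forall>a\<in>A. \<forall>b\<in>B. E a b) \<or> (\<forall>a\<in>A. \<forall>b\<in>B. \<not> E a b)"
      using insert.IH by blast
    then consider "\<forall>a\<in>A. \<forall>b\<in>B. \<not> \<not> E a b" | "\<forall>a\<in>A. \<forall>b\<in>B. \<not> E a b" by blast
    then show ?thesis
    proof cases
      case 1
      have "\<exists>A B. splits (insert v V) A B \<and>
          ((\<forall>a\<in>A. \<forall>b\<in>B. \<not> E a b) \<or> (\<forall>a\<in>A. \<forall>b\<in>B. \<not> \<not> E a b))"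
        using split_insert_vertex[of v V "\<lambda>x y. \<not> E x y" A B]
          P4_free_on_complement[OF insert.prems(1) sym] sym insert.hyps(2) AB 1 by blast
      then show ?thesis by blast
    next
      case 2
      show ?thesis
        by (rule split_insert_vertex[OF insert.prems(1) sym insert.hyps(2) AB 2])
    qed
  qed
qed

section \<open>The three conditions\<close>

lemma directed_part_iff: "(a, b) \<in> directed_part R \<longleftrightarrow> (a, b) \<in> R \<and> (b, a) \<notin> R"
  by (simp add: directed_part_def)

lemma symmetric_part_iff: "(a, b) \<in> symmetric_part R \<longleftrightarrow> (a, b) \<in> R \<and> (b, a) \<in> R"
  by (simp add: symmetric_part_def)

text \<open>A directed part is irreflexive and asymmetric, so the diagonal and the reversals of the
  three arrows are absent automatically; only the three remaining vertex pairs, in both directions,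
  have to be tested.\<close>

lemma N_free_directed_part_iff:
  "N_free (directed_part R) \<longleftrightarrow> (\<forall>a b c d. distinct [a, b, c, d] \<longrightarrow>
     (a, b) \<in> directed_part R \<longrightarrow> (c, b) \<in> directed_part R \<longrightarrow> (c, d) \<in> directed_part R \<longrightarrow>
     (a, c) \<in> directed_part R \<or> (c, a) \<in> directed_part R \<or>
     (a, d) \<in> directed_part R \<or> (d, a) \<in> directed_part R \<or>
     (b, d) \<in> directed_part R \<or> (d, b) \<in> directed_part R)"
proof -
  have pattern: "Restr (directed_part R) {a, b, c, d} = {(a, b), (c, b), (c, d)} \<longleftrightarrow>
      (a, b) \<in> directed_part R \<and> (c, b) \<in> directed_part R \<and> (c, d) \<in> directed_part R \<and>
      \<not> ((a, c) \<in> directed_part R \<or> (c, a) \<in> directed_part R \<or>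
         (a, d) \<in> directed_part R \<or> (d, a) \<in> directed_part R \<or>
         (b, d) \<in> directed_part R \<or> (d, b) \<in> directed_part R)"
    if "distinct [a, b, c, d]" for a b c d
  proof -
    have "(x, x) \<notin> directed_part R" for x by (simp add: directed_part_iff)
    moreover have "(x, y) \<in> directed_part R \<Longrightarrow> (y, x) \<notin> directed_part R" for x y
      by (simp add: directed_part_iff)
    ultimately show ?thesis
      using that unfolding set_eq_iff by (simp add: split_paired_all) (smt (verit))
  qed
  have "N_free (directed_part R) \<longleftrightarrow> (\<forall>a b c d. distinct [a, b, c, d] \<longrightarrow>
      Restr (directed_part R) {a, b, c, d} \<noteq> {(a, b), (c, b), (c, d)})"
    unfolding N_free_def by (simp only: not_ex de_Morgan_conj imp_conv_disj)
  then show ?thesis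
    by (simp only:, intro all_cong1 imp_cong refl) (simp only: pattern, blast)
qed

text \<open>Irreflexivity settles the diagonal and symmetry the reversed pairs. This links the
  induced pattern to the form used by \<open>cograph_split\<close>.\<close>

lemma P4_free_symmetric_part_iff:
  assumes "irrefl R"
  shows "P4_free (symmetric_part R) \<longleftrightarrow> P4_free_on UNIV (\<lambda>x y. (x, y) \<in> symmetric_part R)"
proof -
  have pattern: "Restr (symmetric_part R) {a, b, c, d} = {(a, b), (b, a), (b, c), (c, b), (c, d), (d, c)} \<longleftrightarrow>
      (a, b) \<in> symmetric_part R \<and> (b, c) \<in> symmetric_part R \<and> (c, d) \<in> symmetric_part R \<and>
      (a, c) \<notin> symmetric_part R \<and> (b, d) \<notin> symmetric_part R \<and> (a, d) \<notin> symmetric_part R"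
    if "distinct [a, b, c, d]" for a b c d
  proof -
    have "(x, x) \<notin> symmetric_part R" for x using assms by (simp add: symmetric_part_iff irrefl_def)
    moreover have "(x, y) \<in> symmetric_part R \<longleftrightarrow> (y, x) \<in> symmetric_part R" for x y
      by (auto simp: symmetric_part_iff)
    ultimately show ?thesis
      using that unfolding set_eq_iff by (simp add: split_paired_all) (smt (verit))
  qed
  have "P4_free (symmetric_part R) \<longleftrightarrow> (\<forall>a b c d. distinct [a, b, c, d] \<longrightarrow>
      Restr (symmetric_part R) {a, b, c, d} \<noteq> {(a, b), (b, a), (b, c), (c, b), (c, d), (d, c)})"
    unfolding P4_free_def by (simp only: not_ex de_Morgan_conj imp_conv_disj)
  then show ?thesis
    unfolding P4_free_on_def
    by (simp only: ball_UNIV, intro all_cong1 imp_cong refl) (simp only: pattern)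
qed

text \<open>The invariant of the induction on the domain: it bundles everything that passes to
  restrictions.\<close>

definition admissible :: "'a set \<Rightarrow> 'a rel \<Rightarrow> bool" where
  "admissible P R \<longleftrightarrow> R \<subseteq> P \<times> P \<and> irrefl R \<and>
     N_free (directed_part R) \<and> P4_free (symmetric_part R) \<and> weakly_transitive P R"

lemma weakly_transitive_iff:
  assumes "R \<subseteq> P \<times> P"
  shows "weakly_transitive P R \<longleftrightarrow> (\<forall>a b c.
     ((a, b) \<in> directed_part R \<and> (b, c) \<in> R \<longrightarrow> (a, c) \<in> R) \<and>
     ((a, b) \<in> R \<and> (b, c) \<in> directed_part R \<longrightarrow> (a, c) \<in> R))"
  using assms unfolding weakly_transitive_def directed_part_def by blast

section \<open>Heredity under restriction\<close>

lemma directed_part_Restr: "directed_part (Restr R E) = Restr (directed_part R) E"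
  by (auto simp: directed_part_def)

lemma symmetric_part_Restr: "symmetric_part (Restr R E) = Restr (symmetric_part R) E"
  by (auto simp: symmetric_part_def)

lemma N_free_directed_part_Restr:
  assumes "N_free (directed_part R)"
  shows "N_free (directed_part (Restr R E))"
  using assms unfolding N_free_directed_part_iff unfolding directed_part_Restr by blast

lemma P4_free_symmetric_part_Restr:
  assumes "irrefl R" and "P4_free (symmetric_part R)"
  shows "P4_free (symmetric_part (Restr R E))"
proof -
  have "irrefl (Restr R E)" using assms(1) by (auto simp: irrefl_def)
  from P4_free_symmetric_part_iff[OF this] show ?thesis
    using assms(2) unfolding P4_free_symmetric_part_iff[OF assms(1)]
    by (simp add: P4_free_on_def symmetric_part_Restr)
qed

lemma admissible_Restr:
  assumes "admissible P R" and "E \<subseteq> P"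
  shows "admissible E (Restr R E)"
proof -
  have R: "R \<subseteq> P \<times> P" and irr: "irrefl R" and N: "N_free (directed_part R)"
    and P4: "P4_free (symmetric_part R)" and wt: "weakly_transitive P R"
    using assms(1) by (auto simp: admissible_def)
  have "weakly_transitive E (Restr R E)"
    using wt assms(2) unfolding weakly_transitive_def directed_part_Restr by blast
  moreover have "irrefl (Restr R E)" using irr by (auto simp: irrefl_def)
  ultimately show ?thesis
    using N_free_directed_part_Restr[OF N] P4_free_symmetric_part_Restr[OF irr P4]
    by (auto simp: admissible_def)
qed

section \<open>Partitions with uniform cross pairs\<close>

text \<open>The two truth values encode the composition: both true is symmetric series, both false
  is parallel, and exactly one true is directed series, from \<open>A\<close> to \<open>B\<close>
  for \<open>p\<close> and from \<open>B\<close> to \<open>A\<close> for \<open>q\<close>.\<close>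

definition uniform_between :: "'a rel \<Rightarrow> 'a set \<Rightarrow> 'a set \<Rightarrow> bool \<Rightarrow> bool \<Rightarrow> bool" where
  "uniform_between R A B p q \<longleftrightarrow> (\<forall>x\<in>A. \<forall>y\<in>B. ((x, y) \<in> R \<longleftrightarrow> p) \<and> ((y, x) \<in> R \<longleftrightarrow> q))"

lemma uniform_between_Restr_union:
  assumes "R \<subseteq> (A \<union> B) \<times> (A \<union> B)" and "uniform_between R A B p q"
  shows "R = Restr R A \<union> Restr R B \<union> (if p then A \<times> B else {}) \<union> (if q then B \<times> A else {})"
  using assms unfolding uniform_between_def by (cases p; cases q) auto

section \<open>Dicographs are admissible\<close>

text \<open>Treats all compositions at once: a violation of one of the conditions cannot be spread
  over two parts with uniform cross pairs, so it would already occur inside one part.\<close>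

lemma admissible_union:
  assumes R: "R \<subseteq> (A \<union> B) \<times> (A \<union> B)"
    and A: "admissible A (Restr R A)" and B: "admissible B (Restr R B)"
    and unif: "uniform_between R A B p q"
  shows "admissible (A \<union> B) R"
proof -
  have AB: "(x, y) \<in> R \<longleftrightarrow> p" and BA: "(y, x) \<in> R \<longleftrightarrow> q" if "x \<in> A" "y \<in> B" for x y
    using unif that by (auto simp: uniform_between_def)
  have irr: "irrefl R"
    using A B R unfolding admissible_def irrefl_def by blast
  have "N_free (directed_part R)"
    unfolding N_free_directed_part_iff
  proof (intro allI impI)
    fix a b c d
    assume dist: "distinct [a, b, c, d]"
      and e: "(a, b) \<in> directed_part R" "(c, b) \<in> directed_part R" "(c, d) \<in> directed_part R"
    have mem: "a \<in> A \<or> a \<in> B" "b \<in> A \<or> b \<in> B" "c \<in> A \<or> c \<in> B" "d \<in> A \<or> d \<in> B"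
      using e R by (auto simp: directed_part_iff)
    let ?D = "directed_part R"
    let ?goal = "(a, c) \<in> ?D \<or> (c, a) \<in> ?D \<or> (a, d) \<in> ?D \<or> (d, a) \<in> ?D \<or> (b, d) \<in> ?D \<or> (d, b) \<in> ?D"
    have inA: ?goal if "a \<in> A" "b \<in> A" "c \<in> A" "d \<in> A"
      using A dist e that unfolding admissible_def N_free_directed_part_iff
      unfolding directed_part_Restr by blast
    have inB: ?goal if "a \<in> B" "b \<in> B" "c \<in> B" "d \<in> B"
      using B dist e that unfolding admissible_def N_free_directed_part_iff
      unfolding directed_part_Restr by blast
    show ?goal
    proof (cases "{a, b, c, d} \<subseteq> A \<or> {a, b, c, d} \<subseteq> B")
      case True
      then show ?thesis using inA inB by blast
    next
      \<comment> \<open>For each distribution of the four points over both sides, \<open>p\<close>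
        and \<open>q\<close> either make the three arrows contradict each other or turn one of the
        missing pairs into an arrow.\<close>
      case False
      then show ?thesis
        using mem e by (elim disjE) (simp_all add: directed_part_iff AB BA)
    qed
  qed
  moreover have "P4_free (symmetric_part R)"
    unfolding P4_free_symmetric_part_iff[OF irr] P4_free_on_def
  proof (intro ballI impI notI)
    fix a b c d
    let ?S = "symmetric_part R"
    assume dist: "distinct [a, b, c, d]"
      and e: "(a, b) \<in> ?S \<and> (b, c) \<in> ?S \<and> (c, d) \<in> ?S \<and> (a, c) \<notin> ?S \<and> (b, d) \<notin> ?S \<and> (a, d) \<notin> ?S"
    have mem: "a \<in> A \<or> a \<in> B" "b \<in> A \<or> b \<in> B" "c \<in> A \<or> c \<in> B" "d \<in> A \<or> d \<in> B"
      using e R by (auto simp: symmetric_part_iff)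
    have inside: False if "a \<in> E" "b \<in> E" "c \<in> E" "d \<in> E" "admissible E (Restr R E)" for E
    proof -
      have "irrefl (Restr R E)" "P4_free (symmetric_part (Restr R E))"
        using that(5) by (auto simp: admissible_def)
      then have "P4_free_on UNIV (\<lambda>x y. (x, y) \<in> Restr ?S E)"
        using P4_free_symmetric_part_iff[of "Restr R E"] unfolding symmetric_part_Restr by blast
      from this[unfolded P4_free_on_def, rule_format, of a b c d] show False
        using dist e that by simp
    qed
    \<comment> \<open>Cross pairs have the adjacency value \<open>p \<and> q\<close>, so a pair with
      the other value lies within one side.\<close>
    have side: "x \<in> A \<longleftrightarrow> y \<in> A" if xy: "x \<in> A \<or> x \<in> B" "y \<in> A \<or> y \<in> B"
      and neq: "(x, y) \<in> ?S \<longleftrightarrow> \<not> (p \<and> q)" for x y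
    proof (rule ccontr)
      assume "\<not> (x \<in> A \<longleftrightarrow> y \<in> A)"
      then have "x \<in> A \<and> y \<in> B \<or> y \<in> A \<and> x \<in> B" using xy by blast
      then have "(x, y) \<in> ?S \<longleftrightarrow> p \<and> q"
        using AB[of x y] BA[of x y] AB[of y x] BA[of y x] by (auto simp: symmetric_part_iff)
      then show False using neq by blast
    qed
    \<comment> \<open>Both the path and its complement are connected: the three non-edges chain the
      vertices together if cross pairs are adjacent, the three edges if they are not.\<close>
    have "(a \<in> A \<longleftrightarrow> b \<in> A) \<and> (b \<in> A \<longleftrightarrow> c \<in> A) \<and> (c \<in> A \<longleftrightarrow> d \<in> A)"
    proof (cases "p \<and> q")
      case True
      then show ?thesis
        using e side[OF mem(1) mem(3)] side[OF mem(1) mem(4)] side[OF mem(2) mem(4)] by simp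
    next
      case False
      then show ?thesis
        using e side[OF mem(1) mem(2)] side[OF mem(2) mem(3)] side[OF mem(3) mem(4)] by simp
    qed
    then show False
      using mem inside[OF _ _ _ _ A] inside[OF _ _ _ _ B] by blast
  qed
  moreover have "weakly_transitive (A \<union> B) R"
    unfolding weakly_transitive_def
  proof (intro ballI)
    fix a b c
    assume mem: "a \<in> A \<union> B" "b \<in> A \<union> B" "c \<in> A \<union> B"
    let ?goal = "((a, b) \<in> directed_part R \<and> (b, c) \<in> R \<longrightarrow> (a, c) \<in> R) \<and>
      ((a, b) \<in> R \<and> (b, c) \<in> directed_part R \<longrightarrow> (a, c) \<in> R)"
    have inside: ?goal if "a \<in> E" "b \<in> E" "c \<in> E" "admissible E (Restr R E)" for E
    proof -
      have "weakly_transitive E (Restr R E)" using that(4) by (simp add: admissible_def)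
      from this[unfolded weakly_transitive_def, THEN bspec, OF that(1), THEN bspec, OF that(2),
          THEN bspec, OF that(3)]
      show ?thesis using that(1-3) by (simp add: directed_part_iff)
    qed
    show ?goal
    proof (cases "{a, b, c} \<subseteq> A \<or> {a, b, c} \<subseteq> B")
      case True
      then show ?thesis
      proof
        assume "{a, b, c} \<subseteq> A"
        then have "a \<in> A" "b \<in> A" "c \<in> A" by simp_all
        from inside[OF this A] show ?thesis .
      next
        assume "{a, b, c} \<subseteq> B"
        then have "a \<in> B" "b \<in> B" "c \<in> B" by simp_all
        from inside[OF this B] show ?thesis .
      qed
    next
      \<comment> \<open>If \<open>b\<close> is alone on its side, the two pairs cross in opposite
        directions and would need both \<open>p\<close> and \<open>q\<close>, which the directed one
        excludes. Otherwise \<open>(a, c)\<close> crosses in the same direction as one of the given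
        pairs.\<close>
      case False
      then show ?thesis
        using mem unfolding Un_iff by (elim disjE) (simp_all add: directed_part_iff AB BA, blast+)
    qed
  qed
  ultimately show ?thesis
    using R irr by (simp add: admissible_def)
qed

lemma dicograph_admissible: "dicograph P R \<Longrightarrow> admissible P R"
proof (induction rule: dicograph.induct)
  case (singleton x)
  then show ?case
    by (auto simp: admissible_def irrefl_def N_free_def P4_free_def weakly_transitive_def
        directed_part_def symmetric_part_def)
next
  case (sym_series A R\<^sub>1 B R\<^sub>2)
  let ?R = "sym_series A R\<^sub>1 B R\<^sub>2"
  have sub: "R\<^sub>1 \<subseteq> A \<times> A" "R\<^sub>2 \<subseteq> B \<times> B" using sym_series.IH by (auto simp: admissible_def)
  then have "Restr ?R A = R\<^sub>1" "Restr ?R B = R\<^sub>2" "?R \<subseteq> (A \<union> B) \<times> (A \<union> B)"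
    "uniform_between ?R A B True True"
    using sym_series.hyps(3) by (auto simp: sym_series_def uniform_between_def)
  then show ?case using admissible_union[of ?R A B True True] sym_series by simp
next
  case (dir_series A R\<^sub>1 B R\<^sub>2)
  let ?R = "dir_series A R\<^sub>1 B R\<^sub>2"
  have sub: "R\<^sub>1 \<subseteq> A \<times> A" "R\<^sub>2 \<subseteq> B \<times> B" using dir_series.IH by (auto simp: admissible_def)
  then have "Restr ?R A = R\<^sub>1" "Restr ?R B = R\<^sub>2" "?R \<subseteq> (A \<union> B) \<times> (A \<union> B)"
    "uniform_between ?R A B True False"
    using dir_series.hyps(3) by (auto simp: dir_series_def uniform_between_def)
  then show ?case using admissible_union[of ?R A B True False] dir_series by simp
next
  case (parallel A R\<^sub>1 B R\<^sub>2)
  let ?R = "parallel R\<^sub>1 R\<^sub>2"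
  have sub: "R\<^sub>1 \<subseteq> A \<times> A" "R\<^sub>2 \<subseteq> B \<times> B" using parallel.IH by (auto simp: admissible_def)
  then have "Restr ?R A = R\<^sub>1" "Restr ?R B = R\<^sub>2" "?R \<subseteq> (A \<union> B) \<times> (A \<union> B)"
    "uniform_between ?R A B False False"
    using parallel.hyps(3) by (auto simp: parallel_def uniform_between_def)
  then show ?case using admissible_union[of ?R A B False False] parallel by simp
qed

section \<open>Admissible relations are dicographs\<close>

lemma dicograph_union:
  assumes R: "R \<subseteq> (A \<union> B) \<times> (A \<union> B)" and disj: "A \<inter> B = {}"
    and A: "dicograph A (Restr R A)" and B: "dicograph B (Restr R B)"
    and unif: "uniform_between R A B p q"
  shows "dicograph (A \<union> B) R"
proof -
  have eq: "R = Restr R A \<union> Restr R B \<union> (if p then A \<times> B else {}) \<union> (if q then B \<times> A else {})"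
    by (rule uniform_between_Restr_union[OF R unif])
  have disj': "B \<inter> A = {}" using disj by blast
  consider "p" "q" | "p" "\<not> q" | "\<not> p" "q" | "\<not> p" "\<not> q" by blast
  then show ?thesis
  proof cases
    case 1
    then have "R = sym_series A (Restr R A) B (Restr R B)"
      using eq by (simp add: sym_series_def)
    then show ?thesis using dicograph.sym_series[OF A B disj] by simp
  next
    case 2
    then have "R = dir_series A (Restr R A) B (Restr R B)"
      using eq by (simp add: dir_series_def)
    then show ?thesis using dicograph.dir_series[OF A B disj] by simp
  next
    \<comment> \<open>All arrows run from \<open>B\<close> to \<open>A\<close>, so the operands
      change places.\<close>
    case 3
    then have "R = dir_series B (Restr R B) A (Restr R A)"
      using eq by (simp add: dir_series_def Un_ac)
    then show ?thesis using dicograph.dir_series[OF B A disj'] by (simp add: Un_commute)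
  next
    case 4
    then have "R = parallel (Restr R A) (Restr R B)"
      using eq by (simp add: parallel_def)
    then show ?thesis using dicograph.parallel[OF A B disj] by simp
  qed
qed

section \<open>The order structure of the directed part\<close>

text \<open>Weak transitivity gives \<open>(a, c) \<in> R\<close>. If also
  \<open>(c, a) \<in> R\<close>, then composing with the arrow from \<open>a\<close> to
  \<open>b\<close> gives \<open>(c, b) \<in> R\<close>, against the arrow from \<open>b\<close> to
  \<open>c\<close>.\<close>

lemma directed_part_trans:
  assumes "admissible P R" and "(a, b) \<in> directed_part R" and "(b, c) \<in> directed_part R"
  shows "(a, c) \<in> directed_part R"
  using assms weakly_transitive_iff[of R P] unfolding admissible_def directed_part_iff by metis

text \<open>Two consecutive arrows in the same direction along an induced path would compose to a
  forbidden comparability. Hence the orientations alternate, and the path is an N read from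
  \<open>a\<close> or from \<open>d\<close>.\<close>

lemma comparability_P4_free:
  assumes "admissible P R"
  shows "P4_free_on P (\<lambda>x y. (x, y) \<in> directed_part R \<or> (y, x) \<in> directed_part R)"
  unfolding P4_free_on_def
proof (intro ballI impI notI, elim conjE)
  fix a b c d
  let ?D = "directed_part R"
  assume dist: "distinct [a, b, c, d]"
    and e: "(a, b) \<in> ?D \<or> (b, a) \<in> ?D" "(b, c) \<in> ?D \<or> (c, b) \<in> ?D" "(c, d) \<in> ?D \<or> (d, c) \<in> ?D"
    and n: "\<not> ((a, c) \<in> ?D \<or> (c, a) \<in> ?D)" "\<not> ((b, d) \<in> ?D \<or> (d, b) \<in> ?D)"
      "\<not> ((a, d) \<in> ?D \<or> (d, a) \<in> ?D)"
  have tr: "(x, y) \<in> ?D \<Longrightarrow> (y, z) \<in> ?D \<Longrightarrow> (x, z) \<in> ?D" for x y z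
    using directed_part_trans[OF assms] .
  have N: "distinct [a, b, c, d] \<longrightarrow> (a, b) \<in> ?D \<longrightarrow> (c, b) \<in> ?D \<longrightarrow> (c, d) \<in> ?D \<longrightarrow>
     (a, c) \<in> ?D \<or> (c, a) \<in> ?D \<or> (a, d) \<in> ?D \<or> (d, a) \<in> ?D \<or> (b, d) \<in> ?D \<or> (d, b) \<in> ?D" for a b c d
    using assms unfolding admissible_def N_free_directed_part_iff by blast
  consider "(a, b) \<in> ?D" "(c, b) \<in> ?D" "(c, d) \<in> ?D" | "(b, a) \<in> ?D" "(b, c) \<in> ?D" "(d, c) \<in> ?D"
    using e n tr by blast
  then show False
  proof cases
    case 1
    then show False using N[of a b c d] dist n by blast
  next
    case 2
    have "distinct [d, c, b, a]" using dist by auto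
    then show False using N[of d c b a] 2 n by blast
  qed
qed

lemma finite_minimal:
  assumes "admissible P R" and "finite P" and "P \<noteq> {}"
  shows "\<exists>m\<in>P. \<forall>x\<in>P. (x, m) \<notin> directed_part R"
proof -
  have "trans (directed_part R)"
    using directed_part_trans[OF assms(1)] by (blast intro: transI)
  moreover have "irrefl (directed_part R)"
    by (auto simp: irrefl_def directed_part_def)
  ultimately have "acyclic (directed_part R)"
    by (simp add: acyclic_irrefl)
  moreover have "finite (directed_part R)"
  proof (rule finite_subset)
    show "directed_part R \<subseteq> P \<times> P"
      using assms(1) by (auto simp: admissible_def directed_part_def)
  qed (use assms(2) in simp)
  ultimately have "wf (directed_part R)" by (simp add: finite_acyclic_wf)
  then show ?thesis
  proof (rule wfE_min'[OF _ assms(3)])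
    fix m
    assume "m \<in> P" "\<And>x. (x, m) \<in> directed_part R \<Longrightarrow> x \<notin> P"
    then show ?thesis by blast
  qed
qed

text \<open>The cut-off part \<open>L\<close> is nonempty because \<open>m\<close>, being minimal
  and comparable with all of \<open>B\<close>, lies below \<open>B\<close>.\<close>

lemma directed_split:
  assumes adm: "admissible P R" and split: "splits P A B"
    and comp: "\<forall>a\<in>A. \<forall>b\<in>B. (a, b) \<in> directed_part R \<or> (b, a) \<in> directed_part R"
    and m: "m \<in> A" "\<forall>x\<in>P. (x, m) \<notin> directed_part R"
  shows "\<exists>A B p q. splits P A B \<and> uniform_between R A B p q"
proof -
  let ?D = "directed_part R"
  define L where "L = {x\<in>A. \<forall>b\<in>B. (x, b) \<in> ?D}"
  have "m \<in> L" using m comp split by (auto simp: L_def splits_def)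
  moreover have "L \<subseteq> A" by (auto simp: L_def)
  ultimately have "splits P L (P - L)" using split by (auto simp: splits_def)
  moreover have "(x, y) \<in> ?D" if xy: "x \<in> L" "y \<in> P - L" for x y
  proof (cases "y \<in> B")
    case True
    then show ?thesis using that by (simp add: L_def)
  next
    case False
    then have "y \<in> A" using that split by (auto simp: splits_def)
    \<comment> \<open>Since \<open>y\<close> is not in \<open>L\<close>, it fails to lie below some
      \<open>b\<close>; by comparability \<open>b\<close> is below \<open>y\<close>, and
      \<open>x\<close> is below \<open>b\<close>.\<close>
    then obtain b where "b \<in> B" "(b, y) \<in> ?D" using xy comp unfolding L_def by blast
    then show ?thesis using that directed_part_trans[OF adm] by (auto simp: L_def)
  qed
  then have "uniform_between R L (P - L) True False"
    by (simp add: uniform_between_def directed_part_iff)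
  ultimately show ?thesis by blast
qed

section \<open>Components of the comparability graph\<close>

lemma component_split:
  assumes adm: "admissible P R" and fin: "finite P" and split: "splits P A B"
    and incomp: "\<forall>a\<in>A. \<forall>b\<in>B. (a, b) \<notin> directed_part R \<and> (b, a) \<notin> directed_part R"
  shows "\<exists>A B p q. splits P A B \<and> uniform_between R A B p q"
proof -
  let ?D = "directed_part R" and ?S = "symmetric_part R"
  \<comment> \<open>The equivalence relation whose classes are the components of the comparability
    graph.\<close>
  define C where "C = (?D \<union> ?D\<inverse>)\<^sup>*"
  have R: "R \<subseteq> P \<times> P" using adm by (simp add: admissible_def)
  have wt: "(a, b) \<in> ?D \<Longrightarrow> (b, c) \<in> R \<Longrightarrow> (a, c) \<in> R" "(a, b) \<in> R \<Longrightarrow> (b, c) \<in> ?D \<Longrightarrow> (a, c) \<in> R"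
    for a b c
    using adm weakly_transitive_iff[OF R] unfolding admissible_def by blast+
  have symC: "sym C" unfolding C_def by (simp add: sym_rtrancl sym_Un_converse)
  have transC: "trans C" unfolding C_def by (rule trans_rtrancl)
  have reflC: "(x, x) \<in> C" for x by (simp add: C_def)
  have DC: "(x, y) \<in> C" if "(x, y) \<in> ?D \<or> (y, x) \<in> ?D" for x y
    using that by (auto simp: C_def)
  \<comment> \<open>Weak transitivity carries \<open>(z, x)\<close> along the arrow to
    \<open>(z, y)\<close>, and \<open>(y, z)\<close> back to \<open>(x, z)\<close>; since
    \<open>z\<close> is comparable to neither endpoint, each resulting pair is symmetric.\<close>
  have edge: "(z, x) \<in> ?S \<longleftrightarrow> (z, y) \<in> ?S"
    if "(x, y) \<in> ?D" "(z, x) \<notin> ?D" "(x, z) \<notin> ?D" "(z, y) \<notin> ?D" "(y, z) \<notin> ?D" for x y z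
    using that wt unfolding directed_part_iff symmetric_part_iff by metis
  \<comment> \<open>\<open>edge\<close> is iterated along a comparability path; all of its vertices
    stay in the component of \<open>x\<close>, hence incomparable to \<open>z\<close>.\<close>
  have same: "(z, x) \<in> ?S \<longleftrightarrow> (z, y) \<in> ?S" if "(x, y) \<in> C" "(x, z) \<notin> C" for x y z
    using that unfolding C_def
  proof (induction rule: rtrancl_induct)
    case base
    then show ?case by simp
  next
    case (step u v)
    have "(x, v) \<in> C" using step.hyps unfolding C_def by (rule rtrancl_into_rtrancl)
    then have "(u, z) \<notin> C" "(v, z) \<notin> C"
      using step.prems step.hyps(1) transC unfolding C_def[symmetric] by (meson transD)+
    then have "(z, u) \<notin> ?D" "(u, z) \<notin> ?D" "(z, v) \<notin> ?D" "(v, z) \<notin> ?D"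
      using DC by blast+
    then show ?case using step.IH step.prems step.hyps(2) edge by blast
  qed
  \<comment> \<open>One representative per component: equivalent points have the same choice
    predicate, hence the same choice.\<close>
  define f where "f x = (SOME y. (x, y) \<in> C)" for x
  have fC: "(x, f x) \<in> C" for x unfolding f_def using reflC by (rule someI)
  have f_eq: "f x = f y" if "(x, y) \<in> C" for x y
  proof -
    have "(x, z) \<in> C \<longleftrightarrow> (y, z) \<in> C" for z
      using that symC transC by (meson symD transD)
    then show ?thesis by (simp add: f_def)
  qed
  \<comment> \<open>\<open>A\<close> is a union of components, so points of \<open>A\<close> and of
    \<open>B\<close> have different representatives. This yields the two vertices that
    \<open>cograph_split\<close> requires.\<close>
  have closed: "y \<in> A" if "(x, y) \<in> C" "x \<in> A" for x y
    using that unfolding C_def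
  proof (induction rule: rtrancl_induct)
    case (step u v)
    then have "u \<in> A" "v \<in> P" using R by (auto simp: directed_part_iff)
    then show ?case using step.hyps(2) incomp split by (auto simp: splits_def)
  qed
  obtain a b where ab: "a \<in> A" "b \<in> B" using split by (auto simp: splits_def)
  have f_neq: "(x, y) \<in> C" if "f x = f y" for x y
    using that fC symC transC by (metis symD transD)
  have "f a \<noteq> f b" using f_neq[of a b] closed[of a b] ab split by (auto simp: splits_def)
  moreover have "f a \<in> f ` P" "f b \<in> f ` P" using ab split by (auto simp: splits_def)
  moreover have "P4_free_on (f ` P) (\<lambda>x y. (x, y) \<in> ?S)"
    using adm P4_free_symmetric_part_iff[of R] unfolding admissible_def P4_free_on_def by blast
  moreover have symS: "(x, y) \<in> ?S \<longleftrightarrow> (y, x) \<in> ?S" for x y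
    by (auto simp: symmetric_part_iff)
  ultimately obtain V W where VW: "splits (f ` P) V W"
    and unif: "(\<forall>v\<in>V. \<forall>w\<in>W. (v, w) \<in> ?S) \<or> (\<forall>v\<in>V. \<forall>w\<in>W. (v, w) \<notin> ?S)"
    using cograph_split[of "f ` P" "\<lambda>x y. (x, y) \<in> ?S" "f a" "f b"] fin by blast
  let ?V = "{x\<in>P. f x \<in> V}" and ?W = "{x\<in>P. f x \<in> W}"
  have "V \<subseteq> f ` P" "W \<subseteq> f ` P" using VW by (auto simp: splits_def)
  moreover obtain v w where "v \<in> V" "w \<in> W" using VW by (auto simp: splits_def)
  ultimately have "?V \<noteq> {}" "?W \<noteq> {}" by blast+
  moreover have "f x \<in> V \<union> W" if "x \<in> P" for x using VW that by (auto simp: splits_def)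
  ultimately have splitP: "splits P ?V ?W" using VW by (auto simp: splits_def)
  \<comment> \<open>The two points are replaced by their representatives one at a time. Being
    incomparable, \<open>x\<close> and \<open>y\<close> are related in both directions or in
    neither.\<close>
  have pull: "((x, y) \<in> R \<longleftrightarrow> (f x, f y) \<in> ?S) \<and> ((y, x) \<in> R \<longleftrightarrow> (f x, f y) \<in> ?S)"
    if "x \<in> ?V" "y \<in> ?W" for x y
  proof -
    have "f x \<noteq> f y" using that VW by (auto simp: splits_def)
    then have xy: "(x, y) \<notin> C" "(y, x) \<notin> C" using f_eq by metis+
    then have xfy: "(x, f y) \<notin> C" using fC symC transC by (metis symD transD)
    have "(x, y) \<in> ?S \<longleftrightarrow> (x, f y) \<in> ?S" using same[OF fC xy(2)] .
    also have "\<dots> \<longleftrightarrow> (f y, x) \<in> ?S" by (rule symS)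
    also have "\<dots> \<longleftrightarrow> (f y, f x) \<in> ?S" using same[OF fC xfy] .
    also have "\<dots> \<longleftrightarrow> (f x, f y) \<in> ?S" by (rule symS)
    finally have "(x, y) \<in> ?S \<longleftrightarrow> (f x, f y) \<in> ?S" .
    moreover have "(x, y) \<notin> ?D" "(y, x) \<notin> ?D" using DC xy by blast+
    ultimately show ?thesis unfolding directed_part_iff symmetric_part_iff by blast
  qed
  have "uniform_between R ?V ?W True True \<or> uniform_between R ?V ?W False False"
    using unif pull unfolding uniform_between_def by blast
  then show ?thesis using splitP by blast
qed

section \<open>Assembling the decomposition\<close>

lemma admissible_split:
  assumes adm: "admissible P R" and fin: "finite P" and "x \<in> P" "y \<in> P" "x \<noteq> y"
  shows "\<exists>A B p q. splits P A B \<and> uniform_between R A B p q"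
proof -
  let ?D = "directed_part R"
  let ?E = "\<lambda>x y. (x, y) \<in> ?D \<or> (y, x) \<in> ?D"
  obtain A B where split: "splits P A B"
    and "(\<forall>a\<in>A. \<forall>b\<in>B. ?E a b) \<or> (\<forall>a\<in>A. \<forall>b\<in>B. \<not> ?E a b)"
    using cograph_split[OF fin comparability_P4_free[OF adm] _ assms(3-5)] by blast
  then consider (comp) "\<forall>a\<in>A. \<forall>b\<in>B. ?E a b" | (incomp) "\<forall>a\<in>A. \<forall>b\<in>B. \<not> ?E a b" by blast
  then show ?thesis
  proof cases
    case comp
    obtain m where m: "m \<in> P" "\<forall>x\<in>P. (x, m) \<notin> ?D"
      using finite_minimal[OF adm fin] assms(3) by blast
    consider "m \<in> A" | "m \<in> B" using m(1) split by (auto simp: splits_def)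
    then show ?thesis
    proof cases
      case 1
      then show ?thesis using directed_split[OF adm split comp] m(2) by blast
    next
      case 2
      \<comment> \<open>\<open>directed_split\<close> cuts from the side that contains the minimal
        element, so the sides are exchanged.\<close>
      have "\<forall>b\<in>B. \<forall>a\<in>A. ?E b a" using comp by blast
      then show ?thesis using directed_split[OF adm splits_commute[OF split]] 2 m(2) by blast
    qed
  next
    case incomp
    then show ?thesis using component_split[OF adm fin split] by blast
  qed
qed

text \<open>Both sides of a split are nonempty proper subsets, so the recursion ends at singletons,
  where irreflexivity leaves only the empty relation.\<close>

lemma admissible_dicograph:
  assumes "finite P" and "P \<noteq> {}" and "admissible P R"
  shows "dicograph P R"
  using assms
proof (induction P arbitrary: R rule: finite_psubset_induct)
  case (psubset P)
  then have R: "R \<subseteq> P \<times> P" "irrefl R" by (auto simp: admissible_def)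
  show ?case
  proof (cases "\<exists>x. P = {x}")
    case True
    then obtain x where x: "P = {x}" by blast
    then have "R = {}" using R by (auto simp: irrefl_def)
    then show ?thesis using x dicograph.singleton by simp
  next
    case False
    then obtain x y where "x \<in> P" "y \<in> P" "x \<noteq> y" using psubset.prems(1) by blast
    then obtain A B p q where split: "splits P A B" and unif: "uniform_between R A B p q"
      using admissible_split[OF psubset.prems(2) psubset.hyps] by blast
    have AB: "A \<noteq> {}" "B \<noteq> {}" "A \<inter> B = {}" "A \<union> B = P"
      using split by (auto simp: splits_def)
    then have "A \<subset> P" "B \<subset> P" by auto
    then have "dicograph A (Restr R A)" "dicograph B (Restr R B)"
      using psubset.IH AB admissible_Restr[OF psubset.prems(2)] by (simp_all add: psubset_imp_subset)
    then show ?thesis using dicograph_union[of R A B p q] AB R unif by simp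
  qed
qed

theorem theorem1:
  fixes P :: "'a set" and R :: "'a rel"
  assumes "finite P" and "P \<noteq> {}" and "R \<subseteq> P \<times> P" and "irrefl_on P R"
  shows "dicograph P R \<longleftrightarrow>
    N_free (directed_part R) \<and> P4_free (symmetric_part R) \<and> weakly_transitive P R"
proof -
  have "irrefl R" using assms(3,4) unfolding irrefl_on_def by blast
  then have "admissible P R \<longleftrightarrow>
      N_free (directed_part R) \<and> P4_free (symmetric_part R) \<and> weakly_transitive P R"
    using assms(3) by (simp add: admissible_def)
  then show ?thesis
    using admissible_dicograph[OF assms(1,2)] dicograph_admissible by blast
qed

end
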